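(* Fix $p>0$ and let $m=\max(2,p)$. Let $X$ be a real random variable with $0<\mathbb{E}|X|^{m}<\infty$, and for each $d\ge 1$ let $\mathbf{X}=(X_1,\dots,X_d)$ be a random vector whose components are i.i.d. copies of $X$. Then, as $d\to\infty$, $$\frac{\mathbb{E}\Vert \mathbf{X}\Vert_p}{d^{1/p}}\to\mu_p^{1/p}\qquad\text{and}\qquad \frac{\mathbb{E}\Vert \mathbf{X}\Vert_p^{2}}{d^{2/p}}\to\mu_p^{2/p},$$ which implies $$\frac{\sqrt{\operatorname{Var}\Vert \mathbf{X}\Vert_p}}{\mathbb{E}\Vert \mathbf{X}\Vert_p}\to 0,\quad\text{as } d\to\infty.$$
   Context: For $\mathbf{x}=(x_1,\dots,x_d)\in\mathbb{R}^d$ and $0<p<\infty$, $\Vert\mathbf{x}\Vert_p=\left(\sum_{j=1}^d|x_j|^p\right)^{1/p}$ (for all $p>0$, even when $p<1$ and this is not a norm). Notation: $\mu_p=\mathbb{E}|X|^p$. *)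

theory Defs
  imports "HOL-Probability.Probability"
begin

text \<open>Points of \<open>d\<close>-dimensional real space are represented by sequences of which only the
  entries with index in \<open>{1..d}\<close> matter, because the dimension varies in the limit \<open>d \<rightarrow> \<infinity>\<close>.\<close>

definition lp_norm :: "real \<Rightarrow> nat \<Rightarrow> (nat \<Rightarrow> real) \<Rightarrow> real"
  where "lp_norm p d x = (\<Sum>j = 1..d. \<bar>x j\<bar> powr p) powr (1 / p)"

definition iid_copies ::
  "'b measure \<Rightarrow> 'i set \<Rightarrow> ('i \<Rightarrow> 'b \<Rightarrow> real) \<Rightarrow> 'a measure \<Rightarrow> ('a \<Rightarrow> real) \<Rightarrow> bool"
  where "iid_copies M I Y N X \<longleftrightarrow>
    prob_space.indep_vars M (\<lambda>_. borel) Y I \<and>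
    (\<forall>j\<in>I. distr M borel (Y j) = distr N borel X)"

end

theory Submission imports Defs begin

text \<open>Put \<open>q = m / p\<close>, so that \<open>q \<ge> 1\<close> and \<open>q \<ge> 2 / p\<close>. Truncating at level \<open>K\<close> and using
  the second moment of the truncated part and convexity for the rest shows that the average \<open>A\<close> of
  \<open>\<bar>X\<^sub>1\<bar>\<^sup>p, \<dots>, \<bar>X\<^sub>d\<bar>\<^sup>p\<close> tends to \<open>\<mu>\<close> in \<open>L\<^sup>q\<close>. Because \<open>q \<ge> 2 / p\<close>, for every \<open>\<epsilon> > 0\<close> there is
  a \<open>C\<close> such that \<open>(a\<^bsup>1/p\<^esup> - \<mu>\<^bsup>1/p\<^esup>)\<^sup>2 \<le> \<epsilon> + C \<bar>a - \<mu>\<bar>\<^sup>q\<close> for all \<open>a \<ge> 0\<close>, hence the normalised norm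
  \<open>A\<^bsup>1/p\<^esup>\<close> tends to \<open>\<mu>\<^bsup>1/p\<^esup>\<close> in \<open>L\<^sup>2\<close>. This gives both moments and makes the variance vanish
  in the limit, while \<open>\<mu> > 0\<close>.\<close>

section \<open>Elementary inequalities for real powers\<close>

lemma convex_on_abs_powr:
  fixes q :: real
  assumes "q \<ge> 1"
  shows "convex_on UNIV (\<lambda>x::real. \<bar>x\<bar> powr q)"
proof (rule convex_onI)
  fix t x y :: real
  assume t: "0 < t" "t < 1"
  \<comment> \<open>From \<open>s powr q <= s\<close> on [0, 1]. This settles the case where
    \<open>x\<close> or \<open>y\<close> is 0; for two nonzero points convexity on the positive
    reals applies to \<open>\<bar>x\<bar>\<close> and \<open>\<bar>y\<bar>\<close>.\<close>
  have scale: "(s * z) powr q \<le> s * z powr q" if "0 \<le> s" "s \<le> 1" "0 \<le> z" for s z :: real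
    using that assms powr_mono'[of 1 q s]
    by (simp add: powr_mult mult_right_mono)
  have "\<bar>(1 - t) *\<^sub>R x + t *\<^sub>R y\<bar> powr q \<le> ((1 - t) * \<bar>x\<bar> + t * \<bar>y\<bar>) powr q"
    using t assms abs_triangle_ineq[of "(1 - t) * x" "t * y"]
    by (intro powr_mono2) (auto simp: abs_mult)
  also have "\<dots> \<le> (1 - t) * \<bar>x\<bar> powr q + t * \<bar>y\<bar> powr q"
  proof (cases "x = 0 \<or> y = 0")
    case True
    then show ?thesis
      using t scale[of t "\<bar>y\<bar>"] scale[of "1 - t" "\<bar>x\<bar>"] by auto
  next
    case False
    then show ?thesis
      using convex_onD[OF powr_convex[OF assms], of t "\<bar>x\<bar>" "\<bar>y\<bar>"] t by simp
  qed
  finally show "\<bar>(1 - t) *\<^sub>R x + t *\<^sub>R y\<bar> powr q \<le> (1 - t) * \<bar>x\<bar> powr q + t * \<bar>y\<bar> powr q" .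
qed simp

text \<open>Jensen's inequality with the equal weights \<open>1 / d\<close>.\<close>

lemma abs_average_powr_le:
  fixes q :: real and f :: "nat \<Rightarrow> real"
  assumes "q \<ge> 1" "d \<ge> 1"
  shows "\<bar>(\<Sum>j=1..d. f j) / d\<bar> powr q \<le> (\<Sum>j=1..d. \<bar>f j\<bar> powr q) / d"
  using convex_on_sum[OF _ _ convex_on_abs_powr[OF assms(1)], of "{1..d}" "\<lambda>_. 1 / d" f] assms(2)
  by (simp add: sum_divide_distrib)

text \<open>The sum is at most three times the largest absolute value, and the q-th power of that
  value is one of the three summands on the right.\<close>

lemma abs_add3_powr_le:
  fixes x y z q :: real
  assumes "q \<ge> 0"
  shows "\<bar>x + y + z\<bar> powr q \<le> 3 powr q * (\<bar>x\<bar> powr q + \<bar>y\<bar> powr q + \<bar>z\<bar> powr q)"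
proof -
  define w where "w = max \<bar>x\<bar> (max \<bar>y\<bar> \<bar>z\<bar>)"
  have "\<bar>x + y + z\<bar> powr q \<le> (3 * w) powr q"
    using assms by (intro powr_mono2) (auto simp: w_def)
  also have "\<dots> = 3 powr q * w powr q"
    by (simp add: powr_mult w_def)
  also have "w powr q \<le> \<bar>x\<bar> powr q + \<bar>y\<bar> powr q + \<bar>z\<bar> powr q"
    unfolding w_def max_def by simp
  finally show ?thesis by simp
qed

text \<open>Lets a second moment control a q-th moment of a bounded variable, whether
  \<open>q\<close> lies below or above 2. Small \<open>t\<close> are absorbed by
  \<open>\<epsilon>\<close>; away from 0 both \<open>\<bar>t\<bar> powr q\<close> and
  \<open>1 / t\<^sup>2\<close> are bounded.\<close>

lemma bounded_powr_le_square:
  fixes q K \<epsilon> :: real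
  assumes "q \<ge> 1" "\<epsilon> > 0"
  shows "\<exists>C\<ge>0. \<forall>t. \<bar>t\<bar> \<le> K \<longrightarrow> \<bar>t\<bar> powr q \<le> \<epsilon> + C * t\<^sup>2"
proof -
  \<comment> \<open>The threshold at which \<open>\<bar>t\<bar> powr q\<close> reaches
    \<open>\<epsilon>\<close>.\<close>
  define \<delta> where "\<delta> = \<epsilon> powr (1 / q)"
  have \<delta>: "\<delta> > 0" "\<delta> powr q = \<epsilon>"
    using assms by (auto simp: \<delta>_def powr_powr)
  have "\<bar>t\<bar> powr q \<le> \<epsilon> + K powr q / \<delta>\<^sup>2 * t\<^sup>2" if t: "\<bar>t\<bar> \<le> K" for t
  proof (cases "\<bar>t\<bar> \<le> \<delta>")
    case True
    then have "\<bar>t\<bar> powr q \<le> \<delta> powr q"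
      using assms by (intro powr_mono2) auto
    then show ?thesis using \<delta> by (simp add: add_increasing2)
  next
    case False
    then have "\<delta>\<^sup>2 \<le> t\<^sup>2"
      using \<delta>(1) by (metis abs_le_square_iff abs_of_pos linorder_not_le nless_le)
    then have "1 \<le> t\<^sup>2 / \<delta>\<^sup>2" using \<delta> by simp
    moreover have "\<bar>t\<bar> powr q \<le> K powr q"
      using assms t by (intro powr_mono2) auto
    ultimately have "\<bar>t\<bar> powr q * 1 \<le> K powr q * (t\<^sup>2 / \<delta>\<^sup>2)"
      by (intro mult_mono) auto
    then show ?thesis using assms by simp
  qed
  then show ?thesis by (intro exI[of _ "K powr q / \<delta>\<^sup>2"]) auto
qed

text \<open>Near \<open>b\<close> continuity of the power gives the \<open>\<epsilon>\<close>. At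
  distance at least \<open>\<delta>\<close> from \<open>b\<close>, both \<open>a\<close> and
  \<open>b\<close> are at most a multiple of \<open>\<bar>a - b\<bar>\<close>, so the left side is
  of order \<open>\<bar>a - b\<bar> powr (2 * r)\<close>, and \<open>2 * r <= q\<close> allows the
  exponent to be raised.\<close>

lemma powr_diff_square_le:
  fixes r q b \<epsilon> :: real
  assumes "r > 0" "2 * r \<le> q" "b \<ge> 0" "\<epsilon> > 0"
  shows "\<exists>C\<ge>0. \<forall>a\<ge>0. (a powr r - b powr r)\<^sup>2 \<le> \<epsilon> + C * \<bar>a - b\<bar> powr q"
proof -
  have "continuous_on {0..} (\<lambda>a::real. a powr r)"
    using assms by (intro continuous_on_powr') auto
  then obtain \<delta> where \<delta>: "\<delta> > 0"
    and close: "\<And>a. a \<ge> 0 \<Longrightarrow> \<bar>a - b\<bar> < \<delta> \<Longrightarrow> \<bar>a powr r - b powr r\<bar> < sqrt \<epsilon>"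
    using assms unfolding continuous_on_iff dist_real_def
    by (metis atLeast_iff real_sqrt_gt_0_iff)
  \<comment> \<open>The first factor comes from
    \<open>max a b <= \<bar>a - b\<bar> * (1 + b / \<delta>)\<close>, the second from raising the
    exponent of \<open>\<bar>a - b\<bar> / \<delta> >= 1\<close> from \<open>2 * r\<close> to
    \<open>q\<close>.\<close>
  define C where "C = (1 + b / \<delta>) powr (2 * r) * \<delta> powr (2 * r - q)"
  have "(a powr r - b powr r)\<^sup>2 \<le> \<epsilon> + C * \<bar>a - b\<bar> powr q" if a: "a \<ge> 0" for a
  proof (cases "\<bar>a - b\<bar> < \<delta>")
    case True
    have "(a powr r - b powr r)\<^sup>2 \<le> (sqrt \<epsilon>)\<^sup>2"
      using close[OF a True] by (intro power2_le_iff_abs_le[THEN iffD2]) (auto simp: assms less_imp_le)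
    moreover have "0 \<le> C" by (simp add: C_def)
    ultimately show ?thesis using assms by (simp add: add_increasing2)
  next
    case False
    then have far: "\<delta> \<le> \<bar>a - b\<bar>" by simp
    have "b \<le> \<bar>a - b\<bar> * (b / \<delta>)"
      using mult_right_mono[OF far, of "b / \<delta>"] \<delta> assms by simp
    then have m: "max a b \<le> \<bar>a - b\<bar> * (1 + b / \<delta>)"
      using \<delta> assms by (simp add: distrib_left max_def) (smt (verit))
    have "a powr r \<le> max a b powr r" "b powr r \<le> max a b powr r"
      using a assms by (auto intro!: powr_mono2)
    then have "\<bar>a powr r - b powr r\<bar> \<le> max a b powr r"
      using powr_ge_zero[of a r] powr_ge_zero[of b r] by linarith
    then have "(a powr r - b powr r)\<^sup>2 \<le> (max a b powr r)\<^sup>2"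
      by (simp add: power2_le_iff_abs_le)
    also have "\<dots> = max a b powr (2 * r)"
      by (simp add: power2_eq_square flip: powr_add)
    also have "\<dots> \<le> (\<bar>a - b\<bar> * (1 + b / \<delta>)) powr (2 * r)"
      using a assms m by (intro powr_mono2) auto
    also have "\<dots> = (1 + b / \<delta>) powr (2 * r) * (\<delta> powr (2 * r) * (\<bar>a - b\<bar> / \<delta>) powr (2 * r))"
      using \<delta> assms by (simp add: powr_mult powr_divide)
    also have "\<dots> \<le> (1 + b / \<delta>) powr (2 * r) * (\<delta> powr (2 * r) * (\<bar>a - b\<bar> / \<delta>) powr q)"
      using \<delta> far assms by (intro mult_left_mono powr_mono) auto
    also have "\<dots> = C * \<bar>a - b\<bar> powr q"
      using \<delta> by (simp add: C_def powr_diff powr_divide)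
    finally show ?thesis using assms by simp
  qed
  then show ?thesis by (intro exI[of _ C]) (auto simp: C_def)
qed

section \<open>Second moments of independent sums, and transfer between equal laws\<close>

text \<open>Independence and centering kill the cross terms, leaving only the diagonal. The bound is
  therefore linear in the number of summands, so the average has second moment of order 1 /
  d.\<close>

lemma (in prob_space) second_moment_sum_indep_centered:
  fixes U :: "'i \<Rightarrow> 'a \<Rightarrow> real" and K :: real
  assumes fin: "finite I" and ind: "indep_vars (\<lambda>_. borel) U I"
    and bnd: "\<And>i \<omega>. i \<in> I \<Longrightarrow> \<bar>U i \<omega>\<bar> \<le> K"
    and centered: "\<And>i. i \<in> I \<Longrightarrow> expectation (U i) = 0"
  shows "expectation (\<lambda>\<omega>. (\<Sum>i\<in>I. U i \<omega>)\<^sup>2) \<le> card I * K\<^sup>2"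
proof -
  have meas: "U i \<in> borel_measurable M" if "i \<in> I" for i
    using ind that by (auto simp: indep_vars_def)
  have int: "integrable M (U i)" if "i \<in> I" for i
    using that bnd meas by (intro integrable_const_bound[of _ K]) auto
  have prod_le: "\<bar>U i \<omega> * U j \<omega>\<bar> \<le> K * K" if "i \<in> I" "j \<in> I" for i j \<omega>
    unfolding abs_mult using bnd[OF that(1), of \<omega>] bnd[OF that(2), of \<omega>]
    by (intro mult_mono) auto
  have int2: "integrable M (\<lambda>\<omega>. U i \<omega> * U j \<omega>)" if "i \<in> I" "j \<in> I" for i j
    using that prod_le meas by (intro integrable_const_bound[of _ "K * K"]) auto
  have uncorrelated: "expectation (\<lambda>\<omega>. U i \<omega> * U j \<omega>) = 0"
    if "i \<in> I" "j \<in> I" "i \<noteq> j" for i j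
  proof -
    have "indep_vars (\<lambda>_. borel) U {i, j}"
      using ind that by (auto intro: indep_vars_subset)
    then have "expectation (\<lambda>\<omega>. \<Prod>k\<in>{i, j}. U k \<omega>) = (\<Prod>k\<in>{i, j}. expectation (U k))"
      using that int by (intro indep_vars_lebesgue_integral) auto
    then show ?thesis using that centered by simp
  qed
  have square: "expectation (\<lambda>\<omega>. U i \<omega> * U i \<omega>) \<le> K\<^sup>2" if "i \<in> I" for i
    using that prod_le int2 by (intro integral_le_const) (auto simp: power2_eq_square abs_le_iff)
  have "expectation (\<lambda>\<omega>. (\<Sum>i\<in>I. U i \<omega>)\<^sup>2) = (\<Sum>i\<in>I. \<Sum>j\<in>I. expectation (\<lambda>\<omega>. U i \<omega> * U j \<omega>))"
    using int2 by (simp add: power2_eq_square sum_product)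
  also have "\<dots> = (\<Sum>i\<in>I. \<Sum>j\<in>I. if j = i then expectation (\<lambda>\<omega>. U i \<omega> * U i \<omega>) else 0)"
    using uncorrelated by (intro sum.cong) auto
  also have "\<dots> = (\<Sum>i\<in>I. expectation (\<lambda>\<omega>. U i \<omega> * U i \<omega>))"
    using fin by simp
  also have "\<dots> \<le> card I * K\<^sup>2"
    using square by (intro sum_bounded_above) auto
  finally show ?thesis .
qed

lemma iid_copies_compose:
  assumes "prob_space M" "iid_copies M I Y N X" "X \<in> borel_measurable N"
    and f: "f \<in> borel_measurable borel"
  shows "iid_copies M I (\<lambda>j \<omega>. f (Y j \<omega>)) N (\<lambda>\<omega>. f (X \<omega>))"
proof -
  interpret prob_space M by fact
  have ind: "indep_vars (\<lambda>_. borel) Y I" and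
    eq: "\<And>j. j \<in> I \<Longrightarrow> distr M borel (Y j) = distr N borel X"
    using assms(2) by (auto simp: iid_copies_def)
  have "distr M borel (\<lambda>\<omega>. f (Y j \<omega>)) = distr N borel (\<lambda>\<omega>. f (X \<omega>))" if j: "j \<in> I" for j
  proof -
    have "Y j \<in> borel_measurable M" using ind j by (auto simp: indep_vars_def)
    then show ?thesis
      using distr_distr[OF f, of "Y j" M] distr_distr[OF f assms(3)] eq[OF j] by (simp add: comp_def)
  qed
  moreover have "indep_vars (\<lambda>_. borel) (\<lambda>j \<omega>. f (Y j \<omega>)) I"
    using ind by (rule indep_vars_compose2) (use f in simp)
  ultimately show ?thesis by (auto simp: iid_copies_def)
qed

text \<open>Both sides depend only on the common law of \<open>Y j\<close> and \<open>X\<close> on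
  the real line.\<close>

lemma iid_copies_transfer:
  fixes f :: "real \<Rightarrow> real"
  assumes "prob_space M" "iid_copies M I Y N X" "X \<in> borel_measurable N" "j \<in> I"
    and f: "f \<in> borel_measurable borel"
  shows "integrable M (\<lambda>\<omega>. f (Y j \<omega>)) \<longleftrightarrow> integrable N (\<lambda>\<omega>. f (X \<omega>))"
    and "(\<integral>\<omega>. f (Y j \<omega>) \<partial>M) = (\<integral>\<omega>. f (X \<omega>) \<partial>N)"
proof -
  have Y: "Y j \<in> borel_measurable M" and eq: "distr M borel (Y j) = distr N borel X"
    using assms(2,4) by (auto simp: iid_copies_def prob_space.indep_vars_def[OF assms(1)])
  show "integrable M (\<lambda>\<omega>. f (Y j \<omega>)) \<longleftrightarrow> integrable N (\<lambda>\<omega>. f (X \<omega>))"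
    using integrable_distr_eq[OF Y f] integrable_distr_eq[OF assms(3) f] eq by simp
  show "(\<integral>\<omega>. f (Y j \<omega>) \<partial>M) = (\<integral>\<omega>. f (X \<omega>) \<partial>N)"
    using integral_distr[OF Y f] integral_distr[OF assms(3) f] eq by simp
qed


section \<open>Truncation and integrability\<close>

text \<open>Dominated convergence with majorant \<open>\<bar>X \<omega>\<bar> powr q\<close>: at
  each point the error vanishes as soon as \<open>k\<close> reaches
  \<open>\<bar>X \<omega>\<bar>\<close>.\<close>

lemma truncation_error_tendsto_0:
  fixes X :: "'a \<Rightarrow> real" and q :: real
  assumes [measurable]: "X \<in> borel_measurable N" and "q > 0"
    and int: "integrable N (\<lambda>\<omega>. \<bar>X \<omega>\<bar> powr q)"
  shows "(\<lambda>k. \<integral>\<omega>. \<bar>X \<omega> - max (- real k) (min (X \<omega>) (real k))\<bar> powr q \<partial>N) \<longlonglongrightarrow> 0"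
proof -
  have "(\<lambda>k. \<bar>X \<omega> - max (- real k) (min (X \<omega>) (real k))\<bar> powr q) \<longlonglongrightarrow> 0" for \<omega>
  proof (rule tendsto_eventually)
    have "eventually (\<lambda>k. \<bar>X \<omega>\<bar> \<le> real k) sequentially"
      using real_arch_simple[of "\<bar>X \<omega>\<bar>"] by (metis (mono_tags) eventually_sequentially of_nat_mono order_trans)
    then show "eventually (\<lambda>k. \<bar>X \<omega> - max (- real k) (min (X \<omega>) (real k))\<bar> powr q = 0) sequentially"
      by eventually_elim (auto simp: max_def min_def)
  qed
  moreover have "\<bar>X \<omega> - max (- real k) (min (X \<omega>) (real k))\<bar> powr q \<le> \<bar>X \<omega>\<bar> powr q" for k \<omega>
    using assms(2) by (intro powr_mono2) (auto simp: max_def min_def)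
  ultimately have "(\<lambda>k. \<integral>\<omega>. \<bar>X \<omega> - max (- real k) (min (X \<omega>) (real k))\<bar> powr q \<partial>N)
      \<longlonglongrightarrow> (\<integral>\<omega>. 0 \<partial>N)"
    using int by (intro integral_dominated_convergence[where w = "\<lambda>\<omega>. \<bar>X \<omega>\<bar> powr q"]) auto
  then show ?thesis by simp
qed

lemma (in prob_space) integrable_of_abs_powr:
  fixes X :: "'a \<Rightarrow> real" and q :: real
  assumes [measurable]: "X \<in> borel_measurable M" and "q \<ge> 1"
    and int: "integrable M (\<lambda>\<omega>. \<bar>X \<omega>\<bar> powr q)"
  shows "integrable M X"
proof (rule Bochner_Integration.integrable_bound)
  show "integrable M (\<lambda>\<omega>. 1 + \<bar>X \<omega>\<bar> powr q)" using int by simp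
  \<comment> \<open>The constant 1 covers \<open>\<bar>x\<bar> <= 1\<close> and is integrable
    because the measure is finite.\<close>
  have "\<bar>x\<bar> \<le> 1 + \<bar>x\<bar> powr q" for x :: real
    using powr_mono[of 1 q "\<bar>x\<bar>"] assms(2) by (cases "\<bar>x\<bar> \<le> 1") (auto simp: add_increasing2)
  then show "AE \<omega> in M. norm (X \<omega>) \<le> norm (1 + \<bar>X \<omega>\<bar> powr q)" by simp
qed simp

lemma (in prob_space) integrable_abs_powr_average:
  fixes Y :: "nat \<Rightarrow> 'a \<Rightarrow> real" and q c :: real
  assumes "q \<ge> 1" "d \<ge> 1"
    and [measurable]: "\<And>j. j \<in> {1..d} \<Longrightarrow> Y j \<in> borel_measurable M"
    and int: "\<And>j. j \<in> {1..d} \<Longrightarrow> integrable M (\<lambda>\<omega>. \<bar>Y j \<omega>\<bar> powr q)"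
  shows "integrable M (\<lambda>\<omega>. \<bar>(\<Sum>j=1..d. Y j \<omega>) / d - c\<bar> powr q)"
proof (rule Bochner_Integration.integrable_bound)
  let ?g = "\<lambda>\<omega>. 3 powr q * ((\<Sum>j=1..d. \<bar>Y j \<omega>\<bar> powr q) / d + \<bar>c\<bar> powr q)"
  show "integrable M ?g"
    by (intro Bochner_Integration.integrable_mult_right Bochner_Integration.integrable_add
        Bochner_Integration.integrable_divide Bochner_Integration.integrable_sum int) auto
  show "(\<lambda>\<omega>. \<bar>(\<Sum>j=1..d. Y j \<omega>) / d - c\<bar> powr q) \<in> borel_measurable M" by measurable
  have "\<bar>(\<Sum>j=1..d. Y j \<omega>) / d - c\<bar> powr q \<le> ?g \<omega>" for \<omega>
  proof -
    have "\<bar>(\<Sum>j=1..d. Y j \<omega>) / d - c\<bar> powr q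
        \<le> 3 powr q * (\<bar>(\<Sum>j=1..d. Y j \<omega>) / d\<bar> powr q + \<bar>c\<bar> powr q)"
      \<comment> \<open>The third summand is taken to be 0, and \<open>0 powr q = 0\<close>.\<close>
      using abs_add3_powr_le[of q "(\<Sum>j=1..d. Y j \<omega>) / d" "- c" 0] assms(1) by simp
    also have "\<dots> \<le> ?g \<omega>"
      using abs_average_powr_le[OF assms(1,2), of "\<lambda>j. Y j \<omega>"]
      by (intro mult_left_mono add_right_mono) auto
    finally show ?thesis .
  qed
  then show "AE \<omega> in M. norm (\<bar>(\<Sum>j=1..d. Y j \<omega>) / d - c\<bar> powr q) \<le> norm (?g \<omega>)"
    by (intro AE_I2) (smt (verit) powr_ge_zero real_norm_def)
qed

section \<open>The weak law of large numbers in \<open>L\<^sup>q\<close>\<close>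

text \<open>The deviation splits into the average of centered truncated variables, the average of
  the remainders, and the bias due to truncating the mean. The first is handled by its second moment
  through \<open>C\<close>. Convexity bounds each of the other two by the truncation error, hence
  the factor 2.\<close>

lemma iid_average_deviation_le:
  fixes X :: "'a \<Rightarrow> real" and Y :: "nat \<Rightarrow> 'b \<Rightarrow> real" and q K \<epsilon> C :: real
  assumes q: "q \<ge> 1" and N: "prob_space N" and X[measurable]: "X \<in> borel_measurable N"
    and int: "integrable N (\<lambda>\<omega>. \<bar>X \<omega>\<bar> powr q)"
    and M: "prob_space M" and d: "d \<ge> 1" and iid: "iid_copies M {1..d} Y N X"
    and "K \<ge> 0" "C \<ge> 0" and C: "\<And>t. \<bar>t\<bar> \<le> 2 * K \<Longrightarrow> \<bar>t\<bar> powr q \<le> \<epsilon> + C * t\<^sup>2"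
  defines "T \<equiv> \<lambda>x. max (- K) (min x K)"
  shows "(\<integral>\<omega>. \<bar>(\<Sum>j=1..d. Y j \<omega>) / d - (\<integral>\<omega>. X \<omega> \<partial>N)\<bar> powr q \<partial>M)
    \<le> 3 powr q * (\<epsilon> + C * ((2 * K)\<^sup>2 / d) + 2 * (\<integral>\<omega>. \<bar>X \<omega> - T (X \<omega>)\<bar> powr q \<partial>N))"
proof -
  interpret N: prob_space N by fact
  interpret M: prob_space M by fact
  have [measurable]: "T \<in> borel_measurable borel" by (simp add: T_def)
  have ind: "M.indep_vars (\<lambda>_. borel) Y {1..d}" using iid by (simp add: iid_copies_def)
  have Y[measurable]: "Y j \<in> borel_measurable M" if "j \<in> {1..d}" for j
    using ind that by (auto simp: M.indep_vars_def)
  note transfer = iid_copies_transfer[OF M iid X]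
  have T_le: "\<bar>T x\<bar> \<le> K" for x using \<open>K \<ge> 0\<close> by (auto simp: T_def)
  have rest_le: "\<bar>x - T x\<bar> powr q \<le> \<bar>x\<bar> powr q" for x
    using q \<open>K \<ge> 0\<close> by (intro powr_mono2) (auto simp: T_def max_def min_def)
  have intX: "integrable N X" using N.integrable_of_abs_powr[OF X q int] .
  have intT: "integrable N (\<lambda>\<omega>. T (X \<omega>))"
    using T_le by (intro N.integrable_const_bound[of _ K]) auto
  have int_rest: "integrable N (\<lambda>\<omega>. \<bar>X \<omega> - T (X \<omega>)\<bar> powr q)"
    using rest_le by (intro Bochner_Integration.integrable_bound[OF int]) auto
  define \<tau> where "\<tau> = N.expectation (\<lambda>\<omega>. T (X \<omega>))"
  define \<rho> where "\<rho> = N.expectation (\<lambda>\<omega>. \<bar>X \<omega> - T (X \<omega>)\<bar> powr q)"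
  have \<tau>_le: "\<bar>\<tau>\<bar> \<le> K"
    unfolding \<tau>_def abs_le_iff using T_le intT
    by (auto intro!: N.integral_le_const simp: abs_le_iff simp flip: Bochner_Integration.integral_minus)
  \<comment> \<open>Centering a variable bounded by \<open>K\<close> at its mean doubles the bound,
    which explains the range \<open>2 * K\<close> in the assumption on \<open>C\<close>.\<close>
  define U where "U j \<omega> = T (Y j \<omega>) - \<tau>" for j \<omega>
  have U_le: "\<bar>U j \<omega>\<bar> \<le> 2 * K" for j \<omega>
    using T_le[of "Y j \<omega>"] \<tau>_le by (simp add: U_def)
  have U[measurable]: "U j \<in> borel_measurable M" if "j \<in> {1..d}" for j
    using that unfolding U_def by measurable
  have second: "M.expectation (\<lambda>\<omega>. (\<Sum>j=1..d. U j \<omega>)\<^sup>2) \<le> card {1..d} * (2 * K)\<^sup>2"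
  proof (rule M.second_moment_sum_indep_centered)
    show "M.indep_vars (\<lambda>_. borel) U {1..d}"
      unfolding U_def using ind by (rule M.indep_vars_compose2) simp
    show "M.expectation (U j) = 0" if "j \<in> {1..d}" for j
      using transfer[OF that, of T] intT by (simp add: U_def[abs_def] \<tau>_def M.prob_space)
  qed (use U_le in auto)
  let ?S = "\<lambda>\<omega>. (\<Sum>j=1..d. U j \<omega>) / d"
  let ?V = "\<lambda>\<omega>. (\<Sum>j=1..d. \<bar>Y j \<omega> - T (Y j \<omega>)\<bar> powr q) / d"
  \<comment> \<open>Needed so that the assumption on \<open>C\<close> can be applied at
    \<open>t = ?S \<omega>\<close>.\<close>
  have S_le: "\<bar>?S \<omega>\<bar> \<le> 2 * K" for \<omega>
  proof -
    have "\<bar>\<Sum>j=1..d. U j \<omega>\<bar> \<le> (\<Sum>j=1..d. \<bar>U j \<omega>\<bar>)" by (rule sum_abs)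
    also have "\<dots> \<le> card {1..d} * (2 * K)" using U_le by (intro sum_bounded_above) auto
    finally show ?thesis using d by (simp add: divide_simps mult.commute)
  qed
  have "(?S \<omega>)\<^sup>2 \<le> (2 * K)\<^sup>2" for \<omega>
    using S_le[of \<omega>] by (metis abs_ge_zero power2_abs power_mono)
  then have intS: "integrable M (\<lambda>\<omega>. (?S \<omega>)\<^sup>2)"
    by (intro M.integrable_const_bound[of _ "(2 * K)\<^sup>2"]) auto
  \<comment> \<open>The sum contributes a factor \<open>d\<close>, the normalisation a factor
    \<open>1 / d\<^sup>2\<close>.\<close>
  have ES: "M.expectation (\<lambda>\<omega>. (?S \<omega>)\<^sup>2) \<le> (2 * K)\<^sup>2 / d"
    using second d by (simp add: divide_simps power2_eq_square mult_ac)
  have V: "M.expectation (\<lambda>\<omega>. \<bar>Y j \<omega> - T (Y j \<omega>)\<bar> powr q) = \<rho>"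
    "integrable M (\<lambda>\<omega>. \<bar>Y j \<omega> - T (Y j \<omega>)\<bar> powr q)" if "j \<in> {1..d}" for j
    using transfer[OF that, of "\<lambda>x. \<bar>x - T x\<bar> powr q"] int_rest by (simp_all add: \<rho>_def)
  have intV: "integrable M ?V"
    by (intro Bochner_Integration.integrable_divide Bochner_Integration.integrable_sum V(2))
  have EV: "M.expectation ?V = \<rho>" using V d by simp
  \<comment> \<open>Jensen's inequality for the remainder
    \<open>X \<omega> - T (X \<omega>)\<close>, whose mean is minus the bias.\<close>
  have bias: "\<bar>\<tau> - N.expectation X\<bar> powr q \<le> \<rho>"
  proof -
    have "\<bar>N.expectation (\<lambda>\<omega>. X \<omega> - T (X \<omega>))\<bar> powr q \<le> \<rho>"
      unfolding \<rho>_def using intX intT int_rest convex_on_abs_powr[OF q]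
      by (intro N.jensens_inequality[where I = UNIV]) auto
    then show ?thesis using intX intT by (simp add: \<tau>_def abs_minus_commute)
  qed
  have pointwise: "\<bar>(\<Sum>j=1..d. Y j \<omega>) / d - N.expectation X\<bar> powr q
      \<le> 3 powr q * (\<epsilon> + C * (?S \<omega>)\<^sup>2 + ?V \<omega> + \<rho>)" for \<omega>
  proof -
    have "(\<Sum>j=1..d. Y j \<omega>) / d - N.expectation X
        = ?S \<omega> + (\<Sum>j=1..d. Y j \<omega> - T (Y j \<omega>)) / d + (\<tau> - N.expectation X)"
      using d by (simp add: U_def sum_subtractf field_simps)
    then have "\<bar>(\<Sum>j=1..d. Y j \<omega>) / d - N.expectation X\<bar> powr q \<le> 3 powr q * (\<bar>?S \<omega>\<bar> powr q
        + \<bar>(\<Sum>j=1..d. Y j \<omega> - T (Y j \<omega>)) / d\<bar> powr q + \<bar>\<tau> - N.expectation X\<bar> powr q)"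
      using q by (simp only:) (rule abs_add3_powr_le, simp)
    also have "\<dots> \<le> 3 powr q * (\<epsilon> + C * (?S \<omega>)\<^sup>2 + ?V \<omega> + \<rho>)"
      using bias C[OF S_le] abs_average_powr_le[OF q d, of "\<lambda>j. Y j \<omega> - T (Y j \<omega>)"]
      by (intro mult_left_mono add_mono) auto
    finally show ?thesis .
  qed
  have "integrable M (\<lambda>\<omega>. \<bar>(\<Sum>j=1..d. Y j \<omega>) / d - N.expectation X\<bar> powr q)"
    using transfer[of _ "\<lambda>x. \<bar>x\<bar> powr q"] int Y
    by (intro M.integrable_abs_powr_average[OF q d]) auto
  then have "M.expectation (\<lambda>\<omega>. \<bar>(\<Sum>j=1..d. Y j \<omega>) / d - N.expectation X\<bar> powr q)
      \<le> M.expectation (\<lambda>\<omega>. 3 powr q * (\<epsilon> + C * (?S \<omega>)\<^sup>2 + ?V \<omega> + \<rho>))"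
    using intS intV pointwise by (intro integral_mono) auto
  also have "\<dots> = 3 powr q * (\<epsilon> + C * M.expectation (\<lambda>\<omega>. (?S \<omega>)\<^sup>2) + M.expectation ?V + \<rho>)"
    using intS intV by (simp add: M.prob_space)
  also have "\<dots> \<le> 3 powr q * (\<epsilon> + C * ((2 * K)\<^sup>2 / d) + \<rho> + \<rho>)"
    unfolding EV using ES \<open>C \<ge> 0\<close> by (intro mult_left_mono add_mono) auto
  finally show ?thesis by (simp add: \<rho>_def add_ac)
qed

text \<open>The order of choices matters: first a truncation level \<open>k\<close> making the tail
  small, then \<open>C\<close> depending on \<open>k\<close> and \<open>\<epsilon>\<close>, and only
  then \<open>d\<close> so large that the variance term is small.\<close>

lemma Lq_weak_law:
  fixes X :: "'a \<Rightarrow> real" and Y :: "nat \<Rightarrow> nat \<Rightarrow> 'b \<Rightarrow> real" and q :: real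
  assumes q: "q \<ge> 1" and N: "prob_space N" and X: "X \<in> borel_measurable N"
    and int: "integrable N (\<lambda>\<omega>. \<bar>X \<omega>\<bar> powr q)"
    and M: "\<And>d. d \<ge> 1 \<Longrightarrow> prob_space (M d)"
    and iid: "\<And>d. d \<ge> 1 \<Longrightarrow> iid_copies (M d) {1..d} (Y d) N X"
  shows "(\<lambda>d. \<integral>\<omega>. \<bar>(\<Sum>j=1..d. Y d j \<omega>) / d - (\<integral>\<omega>. X \<omega> \<partial>N)\<bar> powr q \<partial>M d) \<longlonglongrightarrow> 0"
proof (rule LIMSEQ_I)
  fix e :: real
  assume "e > 0"
  \<comment> \<open>The bound has four contributions of size at most \<open>\<epsilon>\<close>: the
    additive \<open>\<epsilon>\<close>, the variance term, and the truncation error twice.\<close>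
  define \<epsilon> where "\<epsilon> = e / (4 * 3 powr q)"
  have \<epsilon>: "\<epsilon> > 0" "3 powr q * (4 * \<epsilon>) = e" using \<open>e > 0\<close> by (auto simp: \<epsilon>_def)
  have "eventually (\<lambda>k. (\<integral>\<omega>. \<bar>X \<omega> - max (- real k) (min (X \<omega>) (real k))\<bar> powr q \<partial>N) < \<epsilon>) sequentially"
    using truncation_error_tendsto_0[OF X _ int] q \<epsilon>(1) by (intro order_tendstoD(2)[of _ 0]) auto
  then obtain k :: nat
    where k: "(\<integral>\<omega>. \<bar>X \<omega> - max (- real k) (min (X \<omega>) (real k))\<bar> powr q \<partial>N) < \<epsilon>"
    by (auto simp: eventually_sequentially)
  obtain C where C: "C \<ge> 0" "\<And>t. \<bar>t\<bar> \<le> 2 * real k \<Longrightarrow> \<bar>t\<bar> powr q \<le> \<epsilon> + C * t\<^sup>2"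
    using bounded_powr_le_square[OF q \<epsilon>(1)] by meson
  have "(\<lambda>d. C * ((2 * real k)\<^sup>2 / real d)) \<longlonglongrightarrow> C * 0"
    by (intro tendsto_mult tendsto_const lim_const_over_n)
  then have "eventually (\<lambda>d. C * ((2 * real k)\<^sup>2 / real d) < \<epsilon>) sequentially"
    using \<epsilon>(1) by (intro order_tendstoD(2)[of _ "C * 0"]) auto
  then obtain n where n: "\<And>d. d \<ge> n \<Longrightarrow> C * ((2 * real k)\<^sup>2 / real d) < \<epsilon>"
    by (auto simp: eventually_sequentially)
  have "norm ((\<integral>\<omega>. \<bar>(\<Sum>j=1..d. Y d j \<omega>) / d - (\<integral>\<omega>. X \<omega> \<partial>N)\<bar> powr q \<partial>M d) - 0) < e"
    (is "norm (?E - 0) < e") if "d \<ge> max n 1" for d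
  proof -
    have d: "d \<ge> n" "d \<ge> 1" using that by auto
    have "?E \<le> 3 powr q * (\<epsilon> + C * ((2 * real k)\<^sup>2 / d)
        + 2 * (\<integral>\<omega>. \<bar>X \<omega> - max (- real k) (min (X \<omega>) (real k))\<bar> powr q \<partial>N))"
      using C(2) by (intro iid_average_deviation_le q N X int M iid d C(1)) auto
    also have "\<dots> < 3 powr q * (4 * \<epsilon>)"
      using k n[OF d(1)] by (intro mult_strict_left_mono) auto
    finally have "?E < e" using \<epsilon>(2) by simp
    moreover have "?E \<ge> 0" by simp
    ultimately show ?thesis by simp
  qed
  then show "\<exists>n. \<forall>d\<ge>n. norm ((\<integral>\<omega>. \<bar>(\<Sum>j=1..d. Y d j \<omega>) / d - (\<integral>\<omega>. X \<omega> \<partial>N)\<bar> powr q \<partial>M d) - 0) < e"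
    by blast
qed

section \<open>From \<open>L\<^sup>2\<close> convergence to a constant to moments and
  variance\<close>

text \<open>Expanding the square expresses the second moment through the \<open>L\<^sup>2\<close>
  distance \<open>?D\<close> and the mean, so everything follows once the mean converges. That in
  turn follows from \<open>(?m1 d - c)\<^sup>2 <= ?D d\<close>.\<close>

lemma moments_tendsto_of_L2:
  fixes W :: "nat \<Rightarrow> 'b \<Rightarrow> real" and c :: real
  assumes M: "\<And>d. d \<ge> 1 \<Longrightarrow> prob_space (M d)"
    and W: "\<And>d. d \<ge> 1 \<Longrightarrow> W d \<in> borel_measurable (M d)"
    and int: "\<And>d. d \<ge> 1 \<Longrightarrow> integrable (M d) (\<lambda>\<omega>. (W d \<omega> - c)\<^sup>2)"
    and lim: "(\<lambda>d. \<integral>\<omega>. (W d \<omega> - c)\<^sup>2 \<partial>M d) \<longlonglongrightarrow> 0"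
  shows "(\<lambda>d. \<integral>\<omega>. W d \<omega> \<partial>M d) \<longlonglongrightarrow> c"
    and "(\<lambda>d. \<integral>\<omega>. (W d \<omega>)\<^sup>2 \<partial>M d) \<longlonglongrightarrow> c\<^sup>2"
    and "(\<lambda>d. \<integral>\<omega>. (W d \<omega> - (\<integral>\<omega>. W d \<omega> \<partial>M d))\<^sup>2 \<partial>M d) \<longlonglongrightarrow> 0"
proof -
  let ?m1 = "\<lambda>d. \<integral>\<omega>. W d \<omega> \<partial>M d" and ?m2 = "\<lambda>d. \<integral>\<omega>. (W d \<omega>)\<^sup>2 \<partial>M d"
  let ?D = "\<lambda>d. \<integral>\<omega>. (W d \<omega> - c)\<^sup>2 \<partial>M d"
  have facts: "(?m1 d - c)\<^sup>2 \<le> ?D d \<and> ?m2 d = ?D d + 2 * c * ?m1 d - c\<^sup>2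
      \<and> (\<integral>\<omega>. (W d \<omega> - ?m1 d)\<^sup>2 \<partial>M d) = ?m2 d - (?m1 d)\<^sup>2" if d: "d \<ge> 1" for d
  proof -
    interpret prob_space "M d" using M[OF d] .
    have "integrable (M d) (\<lambda>\<omega>. W d \<omega> - c)"
      using W[OF d] by (intro square_integrable_imp_integrable[OF _ int[OF d]]) simp
    from Bochner_Integration.integrable_add[OF this, of "\<lambda>_. c"]
    have i1: "integrable (M d) (W d)" by simp
    have sq: "(W d \<omega>)\<^sup>2 = (W d \<omega> - c)\<^sup>2 + 2 * c * W d \<omega> - c\<^sup>2" for \<omega>
      by (simp add: power2_eq_square algebra_simps)
    have i2: "integrable (M d) (\<lambda>\<omega>. (W d \<omega>)\<^sup>2)"
      unfolding sq using i1 int[OF d] by auto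
    have m2: "?m2 d = ?D d + 2 * c * ?m1 d - c\<^sup>2"
      unfolding sq using i1 int[OF d] by (simp add: prob_space)
    have var: "variance (W d) = ?m2 d - (?m1 d)\<^sup>2"
      using i1 i2 by (rule variance_eq)
    \<comment> \<open>Nonnegativity of the variance; inserting the formula for \<open>?m2 d\<close>
      turns this into the bound on \<open>(?m1 d - c)\<^sup>2\<close>.\<close>
    then have "(?m1 d)\<^sup>2 \<le> ?m2 d" using variance_positive[of "W d"] by simp
    moreover have "(?m1 d - c)\<^sup>2 = (?m1 d)\<^sup>2 - 2 * c * ?m1 d + c\<^sup>2"
      by (simp add: power2_eq_square algebra_simps)
    ultimately have "(?m1 d - c)\<^sup>2 \<le> ?D d" using m2 by linarith
    then show ?thesis using m2 var by simp
  qed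
  have "(\<lambda>d. (?m1 d - c)\<^sup>2) \<longlonglongrightarrow> 0"
    using facts by (intro tendsto_sandwich[OF _ _ tendsto_const lim])
      (auto simp: eventually_sequentially intro!: exI[of _ 1])
  then have "(\<lambda>d. sqrt ((?m1 d - c)\<^sup>2)) \<longlonglongrightarrow> sqrt 0" by (rule tendsto_real_sqrt)
  then show m1: "?m1 \<longlonglongrightarrow> c"
    by (simp add: LIM_zero_cancel tendsto_rabs_zero_iff)
  have "(\<lambda>d. ?D d + 2 * c * ?m1 d - c\<^sup>2) \<longlonglongrightarrow> 0 + 2 * c * c - c\<^sup>2"
    by (intro tendsto_intros lim m1)
  moreover have "eventually (\<lambda>d. ?D d + 2 * c * ?m1 d - c\<^sup>2 = ?m2 d) sequentially"
    using facts by (auto simp: eventually_sequentially intro!: exI[of _ 1])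
  ultimately show m2: "?m2 \<longlonglongrightarrow> c\<^sup>2"
    using Lim_transform_eventually by (fastforce simp: power2_eq_square)
  have "(\<lambda>d. ?m2 d - (?m1 d)\<^sup>2) \<longlonglongrightarrow> c\<^sup>2 - c\<^sup>2"
    by (intro tendsto_intros m1 m2)
  moreover have "eventually (\<lambda>d. ?m2 d - (?m1 d)\<^sup>2
      = (\<integral>\<omega>. (W d \<omega> - ?m1 d)\<^sup>2 \<partial>M d)) sequentially"
    using facts by (auto simp: eventually_sequentially intro!: exI[of _ 1])
  ultimately show "(\<lambda>d. \<integral>\<omega>. (W d \<omega> - ?m1 d)\<^sup>2 \<partial>M d) \<longlonglongrightarrow> 0"
    using Lim_transform_eventually by fastforce
qed

section \<open>Application to the normalised p-norm\<close>

theorem proposition2: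
  fixes p m :: real
    and N :: "'a measure" and X :: "'a \<Rightarrow> real"
    and M :: "nat \<Rightarrow> 'b measure" and Y :: "nat \<Rightarrow> nat \<Rightarrow> 'b \<Rightarrow> real"
  defines "m \<equiv> max 2 p"
  assumes "p > 0"
    and "prob_space N"
    and "X \<in> borel_measurable N"
    and "integrable N (\<lambda>\<omega>. \<bar>X \<omega>\<bar> powr m)"
    and "prob_space.expectation N (\<lambda>\<omega>. \<bar>X \<omega>\<bar> powr m) > 0"
    and "\<And>d. d \<ge> 1 \<Longrightarrow> prob_space (M d)"
    and "\<And>d. d \<ge> 1 \<Longrightarrow> iid_copies (M d) {1..d} (Y d) N X"
  defines "\<mu> \<equiv> prob_space.expectation N (\<lambda>\<omega>. \<bar>X \<omega>\<bar> powr p)"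
    and "R \<equiv> (\<lambda>d \<omega>. lp_norm p d (\<lambda>j. Y d j \<omega>))"
  shows "((\<lambda>d. prob_space.expectation (M d) (R d) / real d powr (1 / p))
            \<longlonglongrightarrow> \<mu> powr (1 / p))
       \<and> ((\<lambda>d. prob_space.expectation (M d) (\<lambda>\<omega>. (R d \<omega>)\<^sup>2) / real d powr (2 / p))
            \<longlonglongrightarrow> \<mu> powr (2 / p))
       \<and> ((\<lambda>d. sqrt (prob_space.variance (M d) (R d)) / prob_space.expectation (M d) (R d))
            \<longlonglongrightarrow> 0)"
proof -
  note p = \<open>p > 0\<close> and X[measurable] = \<open>X \<in> borel_measurable N\<close>
  note M = \<open>\<And>d. d \<ge> 1 \<Longrightarrow> prob_space (M d)\<close>
  note iid = \<open>\<And>d. d \<ge> 1 \<Longrightarrow> iid_copies (M d) {1..d} (Y d) N X\<close>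
  interpret N: prob_space N by fact
  \<comment> \<open>The q-th moment of \<open>\<bar>X\<bar> powr p\<close> is the m-th absolute
    moment of \<open>X\<close>. That \<open>m\<close> is at least \<open>p\<close> gives
    \<open>q >= 1\<close>; that it is at least 2 gives \<open>2 / p <= q\<close>.\<close>
  define q where "q = m / p"
  have q: "q \<ge> 1" "2 * (1 / p) \<le> q" "p * q = m"
    using p by (auto simp: q_def m_def field_simps)
  define Z where "Z d j \<omega> = \<bar>Y d j \<omega>\<bar> powr p" for d j \<omega>
  define A where "A d \<omega> = (\<Sum>j=1..d. Z d j \<omega>) / d" for d \<omega>
  define W where "W d \<omega> = A d \<omega> powr (1 / p)" for d \<omega>
  define w where "w = \<mu> powr (1 / p)"
  have intq: "integrable N (\<lambda>\<omega>. \<bar>\<bar>X \<omega>\<bar> powr p\<bar> powr q)"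
    using assms(5) q(3) by (simp add: powr_powr)
  have intp: "integrable N (\<lambda>\<omega>. \<bar>X \<omega>\<bar> powr p)"
    by (rule N.integrable_of_abs_powr[OF _ q(1) intq]) measurable
  have "\<mu> \<ge> 0" by (simp add: \<mu>_def)
  \<comment> \<open>A vanishing p-th moment would force \<open>X\<close> to be 0 almost everywhere,
    contradicting the positive m-th moment. Positivity is what permits the final division by the
    mean.\<close>
  moreover have "\<mu> \<noteq> 0"
  proof
    assume "\<mu> = 0"
    then have "AE \<omega> in N. \<bar>X \<omega>\<bar> powr p = 0"
      unfolding \<mu>_def using intp by (subst (asm) integral_nonneg_eq_0_iff_AE) auto
    then have "N.expectation (\<lambda>\<omega>. \<bar>X \<omega>\<bar> powr m) = N.expectation (\<lambda>\<omega>. 0)"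
      by (intro integral_cong_AE) auto
    then show False using assms(6) by simp
  qed
  ultimately have \<mu>: "\<mu> > 0" by simp
  have Y: "Y d j \<in> borel_measurable (M d)" if "d \<ge> 1" "j \<in> {1..d}" for d j
    using iid[OF that(1)] that(2)
    by (auto simp: iid_copies_def prob_space.indep_vars_def[OF M[OF that(1)]])
  have Z: "Z d j \<in> borel_measurable (M d)" if "d \<ge> 1" "j \<in> {1..d}" for d j
    unfolding Z_def using Y[OF that] by measurable
  have A: "A d \<in> borel_measurable (M d)" if "d \<ge> 1" for d
    unfolding A_def using Z[OF that] by measurable
  have W: "W d \<in> borel_measurable (M d)" if "d \<ge> 1" for d
    unfolding W_def using A[OF that] by measurable
  \<comment> \<open>Holds for \<open>d = 0\<close> too, where division by zero yields 0; hence
    \<open>dev\<close> below can be uniform in all \<open>d\<close>.\<close>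
  have A_nonneg: "A d \<omega> \<ge> 0" for d \<omega>
    by (auto simp: A_def Z_def intro!: divide_nonneg_nonneg sum_nonneg)
  have iidZ: "iid_copies (M d) {1..d} (Z d) N (\<lambda>\<omega>. \<bar>X \<omega>\<bar> powr p)" if "d \<ge> 1" for d
    unfolding Z_def using iid_copies_compose[OF M[OF that] iid[OF that] X, of "\<lambda>x. \<bar>x\<bar> powr p"] by simp
  have limA: "(\<lambda>d. \<integral>\<omega>. \<bar>A d \<omega> - \<mu>\<bar> powr q \<partial>M d) \<longlonglongrightarrow> 0"
    unfolding A_def \<mu>_def using q(1) intq M iidZ by (intro Lq_weak_law) (auto intro: N.prob_space_axioms)
  have intA: "integrable (M d) (\<lambda>\<omega>. \<bar>A d \<omega> - \<mu>\<bar> powr q)" if d: "d \<ge> 1" for d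
    unfolding A_def
  proof (rule prob_space.integrable_abs_powr_average[OF M[OF d] q(1) d Z[OF d]])
    fix j assume "j \<in> {1..d}"
    then show "integrable (M d) (\<lambda>\<omega>. \<bar>Z d j \<omega>\<bar> powr q)"
      using iid_copies_transfer(1)[OF M[OF d] iidZ[OF d], of j "\<lambda>x. \<bar>x\<bar> powr q"] intq by simp
  qed
  have dev: "\<exists>C\<ge>0. \<forall>d \<omega>. (W d \<omega> - w)\<^sup>2 \<le> \<epsilon> + C * \<bar>A d \<omega> - \<mu>\<bar> powr q" if "\<epsilon> > 0" for \<epsilon>
    using powr_diff_square_le[of "1 / p" q \<mu> \<epsilon>] p q \<mu> that A_nonneg unfolding W_def w_def
    by (metis less_imp_le zero_less_divide_1_iff)
  have intW: "integrable (M d) (\<lambda>\<omega>. (W d \<omega> - w)\<^sup>2)" if d: "d \<ge> 1" for d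
  proof -
    interpret prob_space "M d" using M[OF d] .
    \<comment> \<open>For integrability any fixed tolerance will do, here 1.\<close>
    obtain C where "\<And>\<omega>. (W d \<omega> - w)\<^sup>2 \<le> 1 + C * \<bar>A d \<omega> - \<mu>\<bar> powr q"
      using dev[of 1] by auto
    then have "norm ((W d \<omega> - w)\<^sup>2) \<le> norm (1 + C * \<bar>A d \<omega> - \<mu>\<bar> powr q)" for \<omega>
      by (simp add: order_trans[OF _ abs_ge_self])
    moreover have "integrable (M d) (\<lambda>\<omega>. 1 + C * \<bar>A d \<omega> - \<mu>\<bar> powr q)"
      using intA[OF d] by simp
    moreover have "(\<lambda>\<omega>. (W d \<omega> - w)\<^sup>2) \<in> borel_measurable (M d)"
      using W[OF d] by measurable
    ultimately show ?thesis
      using Bochner_Integration.integrable_bound by blast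
  qed
  have limW: "(\<lambda>d. \<integral>\<omega>. (W d \<omega> - w)\<^sup>2 \<partial>M d) \<longlonglongrightarrow> 0"
  proof (rule LIMSEQ_I)
    fix e :: real
    assume "e > 0"
    then obtain C where C: "C \<ge> 0" "\<And>d \<omega>. (W d \<omega> - w)\<^sup>2 \<le> e / 2 + C * \<bar>A d \<omega> - \<mu>\<bar> powr q"
      using dev[of "e / 2"] by auto
    have "(\<lambda>d. C * (\<integral>\<omega>. \<bar>A d \<omega> - \<mu>\<bar> powr q \<partial>M d)) \<longlonglongrightarrow> C * 0"
      by (intro tendsto_intros limA)
    then have "eventually (\<lambda>d. C * (\<integral>\<omega>. \<bar>A d \<omega> - \<mu>\<bar> powr q \<partial>M d) < e / 2) sequentially"
      using \<open>e > 0\<close> by (intro order_tendstoD(2)[of _ "C * 0"]) auto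
    then obtain n where n: "\<And>d. d \<ge> n \<Longrightarrow> C * (\<integral>\<omega>. \<bar>A d \<omega> - \<mu>\<bar> powr q \<partial>M d) < e / 2"
      by (auto simp: eventually_sequentially)
    have "norm ((\<integral>\<omega>. (W d \<omega> - w)\<^sup>2 \<partial>M d) - 0) < e" if "d \<ge> max n 1" for d
    proof -
      have d: "d \<ge> n" "d \<ge> 1" using that by auto
      interpret prob_space "M d" using M[OF d(2)] .
      have "(\<integral>\<omega>. (W d \<omega> - w)\<^sup>2 \<partial>M d) \<le> (\<integral>\<omega>. e / 2 + C * \<bar>A d \<omega> - \<mu>\<bar> powr q \<partial>M d)"
        using intW[OF d(2)] intA[OF d(2)] C(2) by (intro integral_mono) auto
      also have "\<dots> = e / 2 + C * (\<integral>\<omega>. \<bar>A d \<omega> - \<mu>\<bar> powr q \<partial>M d)"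
        using intA[OF d(2)] by (simp add: prob_space)
      finally show ?thesis using n[OF d(1)] by simp
    qed
    then show "\<exists>n. \<forall>d\<ge>n. norm ((\<integral>\<omega>. (W d \<omega> - w)\<^sup>2 \<partial>M d) - 0) < e" by blast
  qed
  note lim = moments_tendsto_of_L2[OF M W intW limW]
  \<comment> \<open>The sum inside the norm is \<open>d\<close> times the average
    \<open>A d\<close>, and the power \<open>1 / p\<close> is multiplicative.\<close>
  have R: "R d = (\<lambda>\<omega>. real d powr (1 / p) * W d \<omega>)" if "d \<ge> 1" for d
    using that by (simp add: R_def lp_norm_def W_def A_def Z_def powr_divide sum_nonneg fun_eq_iff)
  have sq: "(x powr (1 / p))\<^sup>2 = x powr (2 / p)" for x :: real
    by (simp add: power2_eq_square flip: powr_add)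
  \<comment> \<open>The positive scale \<open>real d powr (1 / p)\<close> factors out of the mean
    and the standard deviation, and its square out of the second moment, so it cancels in each
    quotient.\<close>
  have eq: "prob_space.expectation (M d) (R d) / real d powr (1 / p) = (\<integral>\<omega>. W d \<omega> \<partial>M d)
      \<and> prob_space.expectation (M d) (\<lambda>\<omega>. (R d \<omega>)\<^sup>2) / real d powr (2 / p) = (\<integral>\<omega>. (W d \<omega>)\<^sup>2 \<partial>M d)
      \<and> sqrt (prob_space.variance (M d) (R d)) / prob_space.expectation (M d) (R d)
        = sqrt (\<integral>\<omega>. (W d \<omega> - (\<integral>\<omega>. W d \<omega> \<partial>M d))\<^sup>2 \<partial>M d) / (\<integral>\<omega>. W d \<omega> \<partial>M d)"
    if d: "d \<ge> 1" for d
  proof -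
    have s: "real d powr (1 / p) > 0" using d by simp
    show ?thesis
      using s unfolding R[OF d] sq[symmetric] power_mult_distrib
      by (simp add: power_mult_distrib real_sqrt_mult flip: right_diff_distrib)
  qed
  have ev: "eventually (\<lambda>d. f d = g d) sequentially" if "\<And>d. d \<ge> 1 \<Longrightarrow> f d = g d" for f g :: "nat \<Rightarrow> real"
    using that by (auto simp: eventually_sequentially)
  have "(\<lambda>d. sqrt (\<integral>\<omega>. (W d \<omega> - (\<integral>\<omega>. W d \<omega> \<partial>M d))\<^sup>2 \<partial>M d) / (\<integral>\<omega>. W d \<omega> \<partial>M d))
      \<longlonglongrightarrow> sqrt 0 / w"
    \<comment> \<open>The limit \<open>w\<close> of the denominators is nonzero because
      \<open>\<mu> > 0\<close>.\<close>
    using \<mu> by (intro tendsto_divide tendsto_real_sqrt lim) (auto simp: w_def)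
  then have "(\<lambda>d. sqrt (prob_space.variance (M d) (R d)) / prob_space.expectation (M d) (R d))
      \<longlonglongrightarrow> sqrt 0 / w"
    using eq by (subst tendsto_cong[OF ev]) auto
  moreover have "(\<lambda>d. prob_space.expectation (M d) (R d) / real d powr (1 / p)) \<longlonglongrightarrow> w"
    using eq lim(1) by (subst tendsto_cong[OF ev]) auto
  moreover have "(\<lambda>d. prob_space.expectation (M d) (\<lambda>\<omega>. (R d \<omega>)\<^sup>2) / real d powr (2 / p)) \<longlonglongrightarrow> w\<^sup>2"
    using eq lim(2) by (subst tendsto_cong[OF ev]) auto
  ultimately show ?thesis by (simp add: w_def sq)
qed

end
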